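(* Let $X$ be a compact Hausdorff space, $\Delta_1\subset X$ clopen, $\alpha:\Delta_1\to X$ continuous, $\Delta_{-1}=\alpha(\Delta_1)$, and let $\widetilde X$ be the $\alpha$-extension of $X$. Suppose $\alpha$ is injective. Then $\Phi:\widetilde X\to X$, $\Phi(x_0,x_1,\dots)=x_0$, is a homeomorphism if and only if $\Delta_{-1}$ is open.
   Context: For $n\ge1$, $\Delta_n$ is the domain of $\alpha^n$; $\Delta_0=X$. $\alpha$-extension: adjoin to $X$ an isolated point, denoted $0$. $\widetilde X=\bigcup_{N\ge0}X_N\cup X_\infty\subset\prod_{n=0}^\infty(X\cup\{0\})$ with the topology induced from the product topology, where $X_N=\{(x_0,\dots,x_N,0,0,\dots):x_n\in\Delta_n,\ x_N\notin\Delta_{-1},\ \alpha(x_n)=x_{n-1}\text{ for }1\le n\le N\}$ and $X_\infty=\{(x_0,x_1,\dots):x_n\in\Delta_n,\ \alpha(x_n)=x_{n-1}\text{ for }n\ge1\}$. *)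

theory Defs
  imports "HOL-Analysis.Analysis"
begin

text \<open>
  A partial map \<open>\<alpha>\<close> of \<open>X\<close> is given by a domain \<open>D\<close> (the set \<open>\<Delta>\<^sub>1\<close>) and a function
  on the underlying type whose values outside \<open>D\<close> are never used.
  The domain of the partial composition \<open>\<alpha>\<^sup>n\<^sup>+\<^sup>1 = \<alpha>\<^sup>n \<circ> \<alpha>\<close> consists of those points of \<open>D\<close>
  that \<open>\<alpha>\<close> sends into the domain of \<open>\<alpha>\<^sup>n\<close>.
\<close>

primrec iter_domain :: "'a set \<Rightarrow> 'a set \<Rightarrow> ('a \<Rightarrow> 'a) \<Rightarrow> nat \<Rightarrow> 'a set" where
  "iter_domain S D \<alpha> 0 = S"
| "iter_domain S D \<alpha> (Suc n) = {x \<in> D. \<alpha> x \<in> iter_domain S D \<alpha> n}"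

text \<open>
  The space \<open>X \<union> {0}\<close>: the adjoined isolated point is \<open>None\<close>, and \<open>X\<close> is embedded by \<open>Some\<close>.
\<close>

definition adjoin_isolated :: "'a topology \<Rightarrow> 'a option topology" where
  "adjoin_isolated X = topology (\<lambda>U. openin X (Some -` U))"

lemma openin_adjoin_isolated [simp]:
  "openin (adjoin_isolated X) U \<longleftrightarrow> openin X (Some -` U)"
proof -
  have "istopology (\<lambda>U. openin X (Some -` U))"
    unfolding istopology_def by (auto simp: vimage_Union)
  then show ?thesis
    by (simp add: adjoin_isolated_def topology_inverse')
qed

lemma topspace_adjoin_isolated [simp]:
  "topspace (adjoin_isolated X) = insert None (Some ` topspace X)"
proof (rule antisym)
  show "topspace (adjoin_isolated X) \<subseteq> insert None (Some ` topspace X)"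
  proof
    fix y assume "y \<in> topspace (adjoin_isolated X)"
    then obtain U where U: "openin X (Some -` U)" "y \<in> U"
      unfolding topspace_def by auto
    from U(1) have "Some -` U \<subseteq> topspace X" by (rule openin_subset)
    with U(2) show "y \<in> insert None (Some ` topspace X)" by (cases y) auto
  qed
  have "Some -` insert None (Some ` topspace X) = topspace X" by auto
  then have "openin (adjoin_isolated X) (insert None (Some ` topspace X))" by simp
  then show "insert None (Some ` topspace X) \<subseteq> topspace (adjoin_isolated X)"
    by (rule openin_subset)
qed

definition ext_finite :: "'a set \<Rightarrow> 'a set \<Rightarrow> ('a \<Rightarrow> 'a) \<Rightarrow> nat \<Rightarrow> (nat \<Rightarrow> 'a option) set" where
  "ext_finite S D \<alpha> N =
    {(\<lambda>n. if n \<le> N then Some (x n) else None) | x.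
       (\<forall>n\<le>N. x n \<in> iter_domain S D \<alpha> n) \<and> x N \<notin> \<alpha> ` D \<and>
       (\<forall>n. 1 \<le> n \<and> n \<le> N \<longrightarrow> \<alpha> (x n) = x (n - 1))}"

definition ext_infinite :: "'a set \<Rightarrow> 'a set \<Rightarrow> ('a \<Rightarrow> 'a) \<Rightarrow> (nat \<Rightarrow> 'a option) set" where
  "ext_infinite S D \<alpha> =
    {(\<lambda>n. Some (x n)) | x.
       (\<forall>n. x n \<in> iter_domain S D \<alpha> n) \<and> (\<forall>n\<ge>1. \<alpha> (x n) = x (n - 1))}"

definition alpha_extension ::
  "'a topology \<Rightarrow> 'a set \<Rightarrow> ('a \<Rightarrow> 'a) \<Rightarrow> (nat \<Rightarrow> 'a option) topology" where
  "alpha_extension X D \<alpha> =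
    subtopology (product_topology (\<lambda>n. adjoin_isolated X) UNIV)
      ((\<Union>N. ext_finite (topspace X) D \<alpha> N) \<union> ext_infinite (topspace X) D \<alpha>)"

text \<open>
  The projection \<open>(x\<^sub>0, x\<^sub>1, \<dots>) \<mapsto> x\<^sub>0\<close>; on the \<open>\<alpha>\<close>-extension the zeroth entry is always a
  point of \<open>X\<close>, so \<open>the\<close> only undoes the embedding \<open>Some\<close>.
\<close>

definition ext_proj :: "(nat \<Rightarrow> 'a option) \<Rightarrow> 'a" where
  "ext_proj s = the (s 0)"

end

theory Submission
  imports Defs
begin

text \<open>
  Since \<open>\<alpha>\<close> is injective, a point of the \<open>\<alpha>\<close>-extension is the backward orbit of its zeroth entry,
  continued by \<open>0\<close> as soon as it leaves \<open>\<alpha>(\<Delta>\<^sub>1)\<close>; so the projection is always a continuous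
  bijection. The set where the first entry is not \<open>0\<close> is open and projects onto \<open>\<alpha>(\<Delta>\<^sub>1)\<close>, which
  is therefore open if the projection is a homeomorphism. Conversely, \<open>\<alpha>\<close> is a closed map by
  compactness, so if \<open>\<alpha>(\<Delta>\<^sub>1)\<close> is open it is clopen with continuous inverse branch, and each entry
  of the backward orbit depends continuously on the starting point.
\<close>

text \<open>The value \<open>None\<close> off the image is the adjoined point 0. This makes the
  inverse branch a total map into \<open>adjoin_isolated\<close>, so that its continuity can be
  stated on the whole space.\<close>

definition partial_inv :: "'a set \<Rightarrow> ('a \<Rightarrow> 'b) \<Rightarrow> 'b \<Rightarrow> 'a option" where
  "partial_inv D f y = (if y \<in> f ` D then Some (inv_into D f y) else None)"

lemma partial_inv_SomeD: "partial_inv D f y = Some x \<Longrightarrow> x \<in> D \<and> f x = y"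
  by (auto simp: partial_inv_def inv_into_into f_inv_into_f split: if_splits)

lemma partial_inv_f [simp]: "inj_on f D \<Longrightarrow> x \<in> D \<Longrightarrow> partial_inv D f (f x) = Some x"
  by (simp add: partial_inv_def)

lemma partial_inv_None_iff [simp]: "partial_inv D f y = None \<longleftrightarrow> y \<notin> f ` D"
  by (simp add: partial_inv_def)

text \<open>This is the candidate inverse of \<open>ext_proj\<close>. \<open>Option.bind\<close>
  makes \<open>None\<close> absorbing, which produces the tail of zeros.\<close>

primrec backward_orbit :: "'a set \<Rightarrow> ('a \<Rightarrow> 'a) \<Rightarrow> 'a \<Rightarrow> nat \<Rightarrow> 'a option" where
  "backward_orbit D \<alpha> x 0 = Some x"
| "backward_orbit D \<alpha> x (Suc n) = Option.bind (backward_orbit D \<alpha> x n) (partial_inv D \<alpha>)"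

lemma ext_proj_backward_orbit [simp]: "ext_proj (backward_orbit D \<alpha> x) = x"
  by (simp add: ext_proj_def)

text \<open>\<open>iter_domain\<close> applies \<alpha> first, and \<open>\<alpha> y\<close> is the
  entry preceding \<open>y\<close>, so both recursions advance together.\<close>

lemma backward_orbit_in_iter_domain:
  assumes "x \<in> S" "backward_orbit D \<alpha> x n = Some y"
  shows "y \<in> iter_domain S D \<alpha> n"
  using assms(2)
proof (induction n arbitrary: y)
  case 0
  then show ?case using assms(1) by simp
next
  case (Suc n)
  then show ?case
    by (auto simp: bind_eq_Some_conv dest!: partial_inv_SomeD)
qed

lemma backward_orbit_SucD:
  assumes "backward_orbit D \<alpha> x (Suc n) = Some y"
  shows "backward_orbit D \<alpha> x n = Some (\<alpha> y)"
  using assms by (auto simp: bind_eq_Some_conv dest!: partial_inv_SomeD)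

lemma backward_orbit_None_mono:
  assumes "backward_orbit D \<alpha> x m = None" "m \<le> n"
  shows "backward_orbit D \<alpha> x n = None"
  using assms(2,1) by (induction rule: dec_induct) auto

text \<open>An orbit without \<open>None\<close> is an infinite sequence of the extension; otherwise
  the first \<open>None\<close> determines the length \<open>N\<close>.\<close>

lemma backward_orbit_in_extension:
  assumes "x \<in> S"
  shows "backward_orbit D \<alpha> x \<in> (\<Union>N. ext_finite S D \<alpha> N) \<union> ext_infinite S D \<alpha>"
proof -
  let ?b = "backward_orbit D \<alpha> x"
  define y where "y n = the (?b n)" for n
  have dom: "y n \<in> iter_domain S D \<alpha> n" if "?b n \<noteq> None" for n
    using that backward_orbit_in_iter_domain[OF assms] by (auto simp: y_def)
  have step: "\<alpha> (y n) = y (n - 1)" if "?b n \<noteq> None" "1 \<le> n" for n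
  proof (cases n)
    case (Suc m)
    then show ?thesis
      using that backward_orbit_SucD[of D \<alpha> x m "y n"] by (auto simp: y_def simp del: backward_orbit.simps)
  qed (use that in simp)
  show ?thesis
  proof (cases "\<exists>n. ?b n = None")
    case False
    then have "?b = (\<lambda>n. Some (y n))"
      by (auto simp: y_def fun_eq_iff)
    then have "?b \<in> ext_infinite S D \<alpha>"
      using False dom step unfolding ext_infinite_def by blast
    then show ?thesis by blast
  next
    case True
    define M where "M = (LEAST n. ?b n = None)"
    have M: "?b M = None" and least: "\<And>n. n < M \<Longrightarrow> ?b n \<noteq> None"
      using LeastI_ex[OF True] not_less_Least by (auto simp: M_def)
    \<comment> \<open>Entry 0 is never \<open>None\<close>, so the first \<open>None\<close> has a
      predecessor \<open>N\<close>, the last index with a point of the space.\<close>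
    from M obtain N where N: "M = Suc N"
      by (cases M) auto
    have ne: "?b n \<noteq> None" if "n \<le> N" for n
      using that least N by simp
    have "?b n = (if n \<le> N then Some (y n) else None)" for n
      using ne[of n] backward_orbit_None_mono[OF M, of n] N by (auto simp: y_def)
    then have "?b = (\<lambda>n. if n \<le> N then Some (y n) else None)" ..
    moreover have "y N \<notin> \<alpha> ` D"
      using M ne[of N] by (auto simp: N y_def bind_eq_None_conv)
    ultimately have "?b \<in> ext_finite S D \<alpha> N"
      using ne dom step unfolding ext_finite_def by blast
    then show ?thesis by blast
  qed
qed

text \<open>By injectivity each entry has at most one preimage in \<open>D\<close>, so entry 0
  determines all later ones.\<close>

lemma in_extension_is_backward_orbit:
  assumes "inj_on \<alpha> D" "s \<in> (\<Union>N. ext_finite S D \<alpha> N) \<union> ext_infinite S D \<alpha>"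
  shows "s = backward_orbit D \<alpha> (ext_proj s) \<and> ext_proj s \<in> S"
  using assms(2)
proof
  assume "s \<in> (\<Union>N. ext_finite S D \<alpha> N)"
  then obtain N x where s: "s = (\<lambda>n. if n \<le> N then Some (x n) else None)"
    and dom: "\<And>n. n \<le> N \<Longrightarrow> x n \<in> iter_domain S D \<alpha> n" and N: "x N \<notin> \<alpha> ` D"
    and step: "\<And>n. 1 \<le> n \<and> n \<le> N \<Longrightarrow> \<alpha> (x n) = x (n - 1)"
    unfolding ext_finite_def by blast
  have "backward_orbit D \<alpha> (x 0) n = s n" for n
  proof (induction n)
    case (Suc n)
    show ?case
    \<comment> \<open>Below \<open>N\<close> the next entry is the unique preimage; at
      \<open>N\<close> there is no preimage, since \<open>x N\<close> lies outside the image of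
      \<open>D\<close>; beyond \<open>N\<close> the value \<open>None\<close> persists.\<close>
    proof (cases n N rule: linorder_cases)
      case less
      then have "\<alpha> (x (Suc n)) = x n" "x (Suc n) \<in> D"
        using step[of "Suc n"] dom[of "Suc n"] by auto
      then show ?thesis
        using Suc less partial_inv_f[OF assms(1), of "x (Suc n)"] by (simp add: s)
    qed (use Suc N in \<open>auto simp: s\<close>)
  qed (simp add: s)
  then show ?thesis
    using dom[of 0] by (auto simp: s ext_proj_def)
next
  assume "s \<in> ext_infinite S D \<alpha>"
  then obtain x where s: "s = (\<lambda>n. Some (x n))"
    and dom: "\<And>n. x n \<in> iter_domain S D \<alpha> n"
    and step: "\<And>n. n \<ge> 1 \<Longrightarrow> \<alpha> (x n) = x (n - 1)"
    unfolding ext_infinite_def by blast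
  have "backward_orbit D \<alpha> (x 0) n = s n" for n
  proof (induction n)
    case (Suc n)
    have "\<alpha> (x (Suc n)) = x n" "x (Suc n) \<in> D"
      using step[of "Suc n"] dom[of "Suc n"] by auto
    then show ?case
      using Suc partial_inv_f[OF assms(1), of "x (Suc n)"] by (simp add: s)
  qed (simp add: s)
  then show ?thesis
    using dom[of 0] by (auto simp: s ext_proj_def)
qed

lemma topspace_alpha_extension:
  assumes "D \<subseteq> topspace X" "inj_on \<alpha> D"
  shows "topspace (alpha_extension X D \<alpha>) = backward_orbit D \<alpha> ` topspace X"
proof -
  let ?E = "(\<Union>N. ext_finite (topspace X) D \<alpha> N) \<union> ext_infinite (topspace X) D \<alpha>"
  have E: "?E = backward_orbit D \<alpha> ` topspace X"
  proof (intro subset_antisym subsetI)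
    fix s assume "s \<in> ?E"
    from in_extension_is_backward_orbit[OF assms(2) this]
    show "s \<in> backward_orbit D \<alpha> ` topspace X" by blast
  next
    fix s assume "s \<in> backward_orbit D \<alpha> ` topspace X"
    then show "s \<in> ?E" using backward_orbit_in_extension by (elim imageE) simp
  qed
  \<comment> \<open>The carrier of a subtopology is an intersection with the ambient carrier, so the
    entries must be checked to lie in the space with 0 adjoined.\<close>
  have "backward_orbit D \<alpha> x n \<in> insert None (Some ` topspace X)" if "x \<in> topspace X" for x n
  proof (cases n)
    case (Suc m)
    then show ?thesis
      using assms
      by (cases "backward_orbit D \<alpha> x (Suc m)")
        (auto simp: bind_eq_Some_conv dest!: partial_inv_SomeD)
  qed (use that in simp)
  then show ?thesis
    unfolding alpha_extension_def E by (auto simp: topspace_product_topology)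
qed

lemma continuous_map_alpha_extension_coordinate:
  "continuous_map (alpha_extension X D \<alpha>) (adjoin_isolated X) (\<lambda>s. s n)"
  unfolding alpha_extension_def
  by (intro continuous_map_from_subtopology continuous_map_product_projection) simp

lemma continuous_map_ext_proj:
  assumes "D \<subseteq> topspace X" "inj_on \<alpha> D"
  shows "continuous_map (alpha_extension X D \<alpha>) X ext_proj"
  unfolding continuous_map_def
proof (intro conjI allI impI)
  show "ext_proj \<in> topspace (alpha_extension X D \<alpha>) \<rightarrow> topspace X"
    by (auto simp: topspace_alpha_extension[OF assms])
next
  fix U assume "openin X U"
  \<comment> \<open>\<open>the None\<close> is unspecified, so the preimage of \<open>U\<close> is
    described through entry 0 before \<open>the\<close> is applied.\<close>
  then have "openin (adjoin_isolated X) (Some ` U)"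
    by (simp add: inj_vimage_image_eq)
  then have "openin (alpha_extension X D \<alpha>)
      {s \<in> topspace (alpha_extension X D \<alpha>). s 0 \<in> Some ` U}"
    using openin_continuous_map_preimage[OF continuous_map_alpha_extension_coordinate] by fast
  also have "{s \<in> topspace (alpha_extension X D \<alpha>). s 0 \<in> Some ` U} =
      {s \<in> topspace (alpha_extension X D \<alpha>). ext_proj s \<in> U}"
    by (auto simp: topspace_alpha_extension[OF assms])
  finally show "openin (alpha_extension X D \<alpha>)
      {s \<in> topspace (alpha_extension X D \<alpha>). ext_proj s \<in> U}" .
qed

text \<open>Extending \<open>f\<close> by 0 at 0 keeps it continuous because openness in
  \<open>adjoin_isolated\<close> is tested on the \<open>Some\<close> part only. This passes
  continuity from one orbit entry to the next.\<close>

lemma continuous_map_adjoin_isolated_bind: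
  assumes "continuous_map X (adjoin_isolated Y) f"
  shows "continuous_map (adjoin_isolated X) (adjoin_isolated Y) (\<lambda>z. Option.bind z f)"
  unfolding continuous_map_def
proof (intro conjI allI impI)
  show "(\<lambda>z. Option.bind z f) \<in> topspace (adjoin_isolated X) \<rightarrow> topspace (adjoin_isolated Y)"
    using continuous_map_funspace[OF assms] by (auto simp: Pi_iff)
next
  fix U assume "openin (adjoin_isolated Y) U"
  then have "openin X {x \<in> topspace X. f x \<in> U}"
    by (rule openin_continuous_map_preimage[OF assms])
  moreover have "Some -` {z \<in> topspace (adjoin_isolated X). Option.bind z f \<in> U}
      = {x \<in> topspace X. f x \<in> U}"
    by auto
  ultimately show "openin (adjoin_isolated X)
      {z \<in> topspace (adjoin_isolated X). Option.bind z f \<in> U}"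
    by simp
qed

text \<open>\<open>D\<close> is compact and \<open>Y\<close> Hausdorff, so \<open>f\<close> is a
  closed map on \<open>D\<close> and its open image is clopen. Both pieces of a preimage are then
  open.\<close>

lemma continuous_map_partial_inv:
  assumes "compact_space X" "Hausdorff_space Y" "closedin X D"
    and "continuous_map (subtopology X D) Y f" "inj_on f D" "openin Y (f ` D)"
  shows "continuous_map Y (adjoin_isolated X) (partial_inv D f)"
  unfolding continuous_map_def
proof (intro conjI allI impI)
  have D: "D \<subseteq> topspace X"
    using assms(3) by (rule closedin_subset)
  show "partial_inv D f \<in> topspace Y \<rightarrow> topspace (adjoin_isolated X)"
    by (auto simp: partial_inv_def intro!: imageI subsetD[OF D] inv_into_into)
  have "compact_space (subtopology X D)"
    using assms(1,3) by (simp add: closedin_compact_space compact_space_subtopology)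
  then have closed_map: "closed_map (subtopology X D) Y f"
    using assms(2,4) by (simp add: continuous_imp_closed_map)
  have closed_image: "closedin Y (f ` C)" if "closedin X C" "C \<subseteq> D" for C
    using closed_map that assms(3) by (simp add: closed_map_def closedin_closed_subtopology)
  fix U assume "openin (adjoin_isolated X) U"
  then have U: "openin X (Some -` U)" by simp
  have "closedin X (D - Some -` U)"
    using assms(3) U by blast
  then have "openin Y (f ` D - f ` (D - Some -` U))"
    using assms(6) closed_image by blast
  moreover have "openin Y (topspace Y - f ` D)"
    using closed_image[OF assms(3)] by blast
  \<comment> \<open>By injectivity, an image point has its preimage in \<open>U\<close> exactly when
    it avoids the image of the rest of \<open>D\<close>. All points off the image go to
    \<open>None\<close>.\<close>
  moreover have "{y \<in> topspace Y. partial_inv D f y \<in> U} =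
      (f ` D - f ` (D - Some -` U)) \<union> (if None \<in> U then topspace Y - f ` D else {})"
    using assms(5) openin_subset[OF assms(6)]
    by (auto simp: partial_inv_def inj_on_eq_iff)
  ultimately show "openin Y {y \<in> topspace Y. partial_inv D f y \<in> U}"
    by auto
qed

theorem proposition2p3:
  fixes X :: "'a topology" and D :: "'a set" and \<alpha> :: "'a \<Rightarrow> 'a"
  assumes "compact_space X" and "Hausdorff_space X"
    and "openin X D" and "closedin X D"
    and "continuous_map (subtopology X D) X \<alpha>"
    and "inj_on \<alpha> D"
  shows "homeomorphic_map (alpha_extension X D \<alpha>) X ext_proj \<longleftrightarrow> openin X (\<alpha> ` D)"
proof -
  have D: "D \<subseteq> topspace X"
    using assms(4) by (rule closedin_subset)
  note top = topspace_alpha_extension[OF D assms(6)]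
  let ?E = "alpha_extension X D \<alpha>"
  have im: "\<alpha> ` D \<subseteq> topspace X"
    using continuous_map_image_subset_topspace[OF assms(5)] D by (simp add: Int_absorb1)
  show ?thesis
  proof
    assume hom: "homeomorphic_map ?E X ext_proj"
    have "openin (adjoin_isolated X) (Some ` topspace X)"
      by (simp add: inj_vimage_image_eq)
    then have "openin ?E {s \<in> topspace ?E. s 1 \<in> Some ` topspace X}"
      using openin_continuous_map_preimage[OF continuous_map_alpha_extension_coordinate] by fast
    then have "openin X (ext_proj ` {s \<in> topspace ?E. s 1 \<in> Some ` topspace X})"
      using homeomorphic_imp_open_map[OF hom] by (simp add: open_map_def)
    also have "ext_proj ` {s \<in> topspace ?E. s 1 \<in> Some ` topspace X} = \<alpha> ` D"
    proof
      show "ext_proj ` {s \<in> topspace ?E. s 1 \<in> Some ` topspace X} \<subseteq> \<alpha> ` D"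
        by (auto simp: top dest!: partial_inv_SomeD)
      show "\<alpha> ` D \<subseteq> ext_proj ` {s \<in> topspace ?E. s 1 \<in> Some ` topspace X}"
      proof
        \<comment> \<open>The orbit of \<open>y\<close> is the witness: its entry 1 is the preimage
          of \<open>y\<close> in \<open>D\<close>.\<close>
        fix y assume "y \<in> \<alpha> ` D"
        then have "backward_orbit D \<alpha> y \<in> {s \<in> topspace ?E. s 1 \<in> Some ` topspace X}"
          using assms(6) D im by (auto simp: top)
        then show "y \<in> ext_proj ` {s \<in> topspace ?E. s 1 \<in> Some ` topspace X}"
          by (rule rev_image_eqI) simp
      qed
    qed
    finally show "openin X (\<alpha> ` D)" .
  next
    assume "openin X (\<alpha> ` D)"
    then have inv: "continuous_map X (adjoin_isolated X) (partial_inv D \<alpha>)"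
      using assms continuous_map_partial_inv by blast
    have "continuous_map X (adjoin_isolated X) (\<lambda>x. backward_orbit D \<alpha> x n)" for n
    proof (induction n)
      case 0
      show ?case
        by (auto simp: continuous_map_def openin_subset Collect_conj_eq Int_absorb1
            simp flip: vimage_def)
    next
      case (Suc n)
      then show ?case
        using continuous_map_compose[OF Suc continuous_map_adjoin_isolated_bind[OF inv]]
        by (simp add: o_def)
    qed
    then have "continuous_map X (product_topology (\<lambda>n. adjoin_isolated X) UNIV) (backward_orbit D \<alpha>)"
      by (simp add: continuous_map_componentwise_UNIV)
    then have "continuous_map X ?E (backward_orbit D \<alpha>)"
      unfolding alpha_extension_def
      by (rule continuous_map_into_subtopology) (intro Pi_I backward_orbit_in_extension)
    \<comment> \<open>By \<open>top\<close> every point of \<open>?E\<close> is an orbit, so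
      \<open>ext_proj_backward_orbit\<close> gives both inverse identities.\<close>
    then have "homeomorphic_maps ?E X ext_proj (backward_orbit D \<alpha>)"
      using continuous_map_ext_proj[OF D assms(6)] by (auto simp: homeomorphic_maps_def top)
    then show "homeomorphic_map ?E X ext_proj"
      by (rule homeomorphic_maps_imp_map)
  qed
qed

end
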